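(* Let $\mathfrak g=\mathfrak{sl}_2$, $\theta$ the automorphism $e\mapsto -e$, $f\mapsto -f$, $h\mapsto h$, and $\mathcal L^{\mathrm{tw}}$ the associated twisted loop algebra of the second kind. For each $\phi \in (\mathcal{L}^{\mathrm{tw},0})^*$, the following are equivalent: (1) $\dim V(\phi) < \infty$. (2) There exist $\nu_1,\nu_{-1} \in \mathbb{C}$, $n \in \mathbb{Z}_{\geq 0}$, and $\alpha_1,\dots,\alpha_n \in \mathbb{C}^\times \setminus \{ \pm 1 \}$ such that $$\phi(w_{a,0}) = \nu_1 \cdot 2^a + \nu_{-1} \cdot (-2)^a + \sum_{i=1}^n (\alpha_i+\alpha_i^{-1})^a \quad \text{for all } a \geq 0.$$
   Context: Let $e,f,h$ be the Chevalley basis of $\mathfrak{sl}_2$ over $\mathbb C$. Let $\mathcal L=\mathbb C[t,t^{-1}]\otimes\mathfrak{sl}_2$ be the loop algebra with $[P\otimes x,Q\otimes y]=PQ\otimes[x,y]$, extend $\theta$ by $\theta(t^m\otimes x)=t^{-m}\otimes\theta(x)$, and let $\mathcal L^{\mathrm{tw}}=\{\mathfrak x\in\mathcal L\mid\theta(\mathfrak x)=\mathfrak x\}$. With $t_\pm=t\pm t^{-1}$ set, for $a,b\in\mathbb Z_{\ge0}$, $x_{a,b}=t_+^at_-^b\otimes e$, $y_{a,b}=t_+^at_-^b\otimes f$, $w_{a,b}=t_+^at_-^b\otimes h$. The set $\{x_{a,1},y_{a,1},w_{a,0}\mid a\ge0\}$ is a basis of $\mathcal L^{\mathrm{tw}}$.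 Let $\mathcal L^{\mathrm{tw},+},\mathcal L^{\mathrm{tw},0}$ be the spans of the $x_{a,1}$, respectively the $w_{a,0}$. For $\phi\in(\mathcal L^{\mathrm{tw},0})^*$ (linear dual), $V(\phi)$ denotes the unique simple quotient of the universal highest weight module of highest weight $\phi$, i.e. the unique simple $\mathcal L^{\mathrm{tw}}$-module generated by a nonzero vector $v_\phi$ with $\mathcal L^{\mathrm{tw},+}v_\phi=0$ and $wv_\phi=\phi(w)v_\phi$ for all $w\in\mathcal L^{\mathrm{tw},0}$. Convention: $z^0=1$ for all $z\in\mathbb C$. *)

theory Defs
  imports "HOL-Analysis.Analysis" "HOL-Library.Poly_Mapping"
begin

section \<open>The loop algebra of sl2\<close>

text \<open>Laurent polynomials are the group algebra of the integers: \<open>Poly_Mapping.single m c\<close>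
  is the monomial \<open>c t^m\<close>, and the product is convolution.\<close>

type_synonym laurent = "int \<Rightarrow>\<^sub>0 complex"

definition tplus :: laurent where
  "tplus = Poly_Mapping.single 1 1 + Poly_Mapping.single (-1) 1"

definition tminus :: laurent where
  "tminus = Poly_Mapping.single 1 1 - Poly_Mapping.single (-1) 1"

definition commutator :: "'a::ring_1^2^2 \<Rightarrow> 'a^2^2 \<Rightarrow> 'a^2^2" where
  "commutator A B = A ** B - B ** A"

definition chev_e :: "complex^2^2" where
  "chev_e = vector [vector [0, 1], vector [0, 0]]"

definition chev_f :: "complex^2^2" where
  "chev_f = vector [vector [0, 0], vector [1, 0]]"

definition chev_h :: "complex^2^2" where
  "chev_h = vector [vector [1, 0], vector [0, -1]]"

text \<open>The tensor product of the Laurent polynomials with the 2 by 2 complex matrices is identified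
  with the 2 by 2 matrices over the Laurent polynomials; the loop algebra consists of
  those of trace zero, with the commutator as bracket (see \<open>commutator_tensor\<close> below).\<close>

definition tensor :: "laurent \<Rightarrow> complex^2^2 \<Rightarrow> laurent^2^2" where
  "tensor P X = (\<chi> i j. P * Poly_Mapping.single 0 (X $ i $ j))"

definition loop_scale :: "complex \<Rightarrow> laurent^2^2 \<Rightarrow> laurent^2^2" where
  "loop_scale c A = (\<chi> i j. Poly_Mapping.single 0 c * A $ i $ j)"

definition loop_algebra :: "(laurent^2^2) set" where
  "loop_algebra = {A. trace A = 0}"

definition theta_sl2 :: "complex^2^2 \<Rightarrow> complex^2^2" where
  "theta_sl2 X = (\<chi> i j. if i = j then X $ i $ j else - (X $ i $ j))"

text \<open>\<open>Poly_Mapping.map_key uminus\<close> is the substitution of \<open>t^(-1)\<close> for \<open>t\<close>.\<close>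

definition theta :: "laurent^2^2 \<Rightarrow> laurent^2^2" where
  "theta A = (\<chi> i j. if i = j then Poly_Mapping.map_key uminus (A $ i $ j)
                       else - Poly_Mapping.map_key uminus (A $ i $ j))"

definition Ltw :: "(laurent^2^2) set" where
  "Ltw = {A \<in> loop_algebra. theta A = A}"

definition x_tw :: "nat \<Rightarrow> nat \<Rightarrow> laurent^2^2" where
  "x_tw a b = tensor (tplus ^ a * tminus ^ b) chev_e"

definition y_tw :: "nat \<Rightarrow> nat \<Rightarrow> laurent^2^2" where
  "y_tw a b = tensor (tplus ^ a * tminus ^ b) chev_f"

definition w_tw :: "nat \<Rightarrow> nat \<Rightarrow> laurent^2^2" where
  "w_tw a b = tensor (tplus ^ a * tminus ^ b) chev_h"

lemma single_zero_mult: "Poly_Mapping.single 0 (a * b) =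
    Poly_Mapping.single (0::int) a * Poly_Mapping.single 0 (b::complex)"
  by (simp add: mult_single)

global_interpretation loop: vector_space loop_scale
  by unfold_locales
    (simp_all add: loop_scale_def vec_eq_iff algebra_simps single_add single_zero_mult)

definition Ltw_plus :: "(laurent^2^2) set" where
  "Ltw_plus = loop.span (range (\<lambda>a. x_tw a 1))"

definition Ltw_zero :: "(laurent^2^2) set" where
  "Ltw_zero = loop.span (range (\<lambda>a. w_tw a 0))"

text \<open>Elements of the dual are represented by functions on all matrices; only their values on
  \<open>Ltw_zero\<close> matter.\<close>

definition Ltw_zero_dual :: "(laurent^2^2 \<Rightarrow> complex) set" where
  "Ltw_zero_dual = {\<phi>.
     (\<forall>x\<in>Ltw_zero. \<forall>y\<in>Ltw_zero. \<phi> (x + y) = \<phi> x + \<phi> y) \<and>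
     (\<forall>c. \<forall>x\<in>Ltw_zero. \<phi> (loop_scale c x) = c * \<phi> x)}"

text \<open>The encodings satisfy the defining relations.\<close>

lemma commutator_tensor:
  "commutator (tensor P X) (tensor Q Y) = tensor (P * Q) (commutator X Y)"
  by (simp add: commutator_def tensor_def vec_eq_iff matrix_matrix_mult_def sum_2
      single_add single_diff single_zero_mult algebra_simps)

lemma commutator_chev:
  "commutator chev_e chev_f = chev_h"
  "commutator chev_h chev_e = 2 *\<^sub>R chev_e"
  "commutator chev_h chev_f = (- 2) *\<^sub>R chev_f"
  by (simp_all add: commutator_def chev_e_def chev_f_def chev_h_def vec_eq_iff
      matrix_matrix_mult_def sum_2 forall_2 scaleR_conv_of_real)

lemma theta_chev:
  "theta_sl2 chev_e = - chev_e" "theta_sl2 chev_f = - chev_f" "theta_sl2 chev_h = chev_h"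
  by (simp_all add: theta_sl2_def chev_e_def chev_f_def chev_h_def vec_eq_iff forall_2)

lemma map_key_uminus_single:
  "Poly_Mapping.map_key uminus (Poly_Mapping.single (m::int) (c::complex)) =
   Poly_Mapping.single (- m) c"
  using map_key_single[of uminus "- m" c] by simp

lemma theta_tensor:
  "theta (tensor (Poly_Mapping.single m 1) X) = tensor (Poly_Mapping.single (- m) 1) (theta_sl2 X)"
  by (simp add: theta_def tensor_def theta_sl2_def vec_eq_iff mult_single map_key_uminus_single
      single_uminus)

section \<open>Modules and highest weight vectors\<close>

locale Ltw_module = vector_space cscale
  for cscale :: "complex \<Rightarrow> 'v::ab_group_add \<Rightarrow> 'v" +
  fixes act :: "laurent^2^2 \<Rightarrow> 'v \<Rightarrow> 'v"
  assumes act_linear: "x \<in> Ltw \<Longrightarrow> Vector_Spaces.linear cscale cscale (act x)"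
    and act_add: "x \<in> Ltw \<Longrightarrow> y \<in> Ltw \<Longrightarrow> act (x + y) u = act x u + act y u"
    and act_scale: "x \<in> Ltw \<Longrightarrow> act (loop_scale c x) u = cscale c (act x u)"
    and act_commutator: "x \<in> Ltw \<Longrightarrow> y \<in> Ltw \<Longrightarrow>
          act (commutator x y) u = act x (act y u) - act y (act x u)"
begin

definition submodule :: "'v set \<Rightarrow> bool" where
  "submodule W \<longleftrightarrow> subspace W \<and> (\<forall>x\<in>Ltw. \<forall>u\<in>W. act x u \<in> W)"

definition simple :: bool where
  "simple \<longleftrightarrow> (UNIV :: 'v set) \<noteq> {0} \<and> (\<forall>W. submodule W \<longrightarrow> W = {0} \<or> W = UNIV)"

definition generated_by :: "'v \<Rightarrow> bool" where
  "generated_by v \<longleftrightarrow> (\<forall>W. submodule W \<and> v \<in> W \<longrightarrow> W = UNIV)"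

definition highest_weight_vector :: "(laurent^2^2 \<Rightarrow> complex) \<Rightarrow> 'v \<Rightarrow> bool" where
  "highest_weight_vector \<phi> v \<longleftrightarrow> v \<noteq> 0 \<and>
     (\<forall>x\<in>Ltw_plus. act x v = 0) \<and> (\<forall>w\<in>Ltw_zero. act w v = cscale (\<phi> w) v)"

end

text \<open>The complex vector space with scalar multiplication \<open>cscale\<close> and action \<open>act\<close> is a model
  of \<open>V(\<phi>)\<close>, the simple quotient of the universal highest weight module; it is unique up to
  isomorphism.\<close>

definition simple_highest_weight_module ::
  "(complex \<Rightarrow> 'v::ab_group_add \<Rightarrow> 'v) \<Rightarrow> (laurent^2^2 \<Rightarrow> 'v \<Rightarrow> 'v) \<Rightarrow>
    (laurent^2^2 \<Rightarrow> complex) \<Rightarrow> bool" where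
  "simple_highest_weight_module cscale act \<phi> \<longleftrightarrow>
     Ltw_module cscale act \<and> Ltw_module.simple cscale act \<and>
     (\<exists>v. Ltw_module.highest_weight_vector cscale act \<phi> v \<and>
          Ltw_module.generated_by cscale act v)"

end

theory Submission
  imports Defs "HOL-Computational_Algebra.Fundamental_Theorem_Algebra"
begin

text \<open>
  Writing \<open>z = t\<^sub>+\<close>, the twisted algebra has elements \<open>e(P)\<close>, \<open>f(P)\<close>, \<open>h(P)\<close> for polynomials
  \<open>P\<close> in \<open>z\<close>, with the brackets of the current algebra of \<open>sl\<^sub>2\<close> except that
  \<open>[e(P), f(Q)] = h(D P Q)\<close>, where \<open>D = t\<^sub>-\<^sup>2 = z\<^sup>2 - 4\<close>. Let \<open>\<psi>(P) = \<phi>(h(P))\<close>. Since \<open>V(\<phi>)\<close> is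
  simple, \<open>f(P) v = 0\<close> as soon as \<open>\<psi>\<close> vanishes on the ideal \<open>(D P)\<close>. The key computation is that
  if \<open>f(D Q P\<^sup>2) v = \<kappa> f(P) v\<close>, then
  \<open>e(Q) f(P)\<^sup>n\<^sup>+\<^sup>1 v = (n + 1) (\<psi>(D Q P) - \<kappa> n) f(P)\<^sup>n v\<close>.

  If \<open>V(\<phi>)\<close> is finite-dimensional, some \<open>f(P)\<close> with \<open>P \<noteq> 0\<close> kills \<open>v\<close>, so \<open>\<psi>\<close> vanishes on a
  nonzero ideal. The case \<open>\<kappa> = 0\<close> shows that it vanishes on the radical of \<open>(D P)\<close>, so that \<open>\<psi>\<close> is a
  combination of evaluations at the roots of \<open>D P\<close>; the case \<open>\<kappa> = 1\<close>, applied to Lagrange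
  polynomials, shows that the coefficients at roots other than \<open>\<plusminus>2\<close> are natural numbers.
  Conversely, if \<open>\<psi>\<close> has this form, \<open>f(P) v\<close> only depends on the values of \<open>P\<close> at the finitely many
  points other than \<open>\<plusminus>2\<close>, the Lagrange polynomials \<open>P\<close> at these points act by nilpotent \<open>f(P)\<close>, and
  monomials in these commuting operators applied to \<open>v\<close> span \<open>V(\<phi>)\<close>.
\<close>

section \<open>Simple highest weight modules in terms of polynomials\<close>

definition rootp :: "complex set \<Rightarrow> complex poly" where
  "rootp A = (\<Prod>a\<in>A. [:-a, 1:])"

lemma poly_rootp_eq_0_iff: "finite A \<Longrightarrow> poly (rootp A) z = 0 \<longleftrightarrow> z \<in> A"
  by (auto simp: rootp_def poly_prod)

text \<open>Linear factors are split off one at a time; the quotient still vanishes at the remaining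
  points because they differ from \<open>a\<close>.\<close>

lemma rootp_dvd:
  assumes "finite A" "\<And>a. a \<in> A \<Longrightarrow> poly p a = 0"
  shows "rootp A dvd p"
  using assms
proof (induction A arbitrary: p rule: finite_induct)
  case empty
  then show ?case by (simp add: rootp_def)
next
  case (insert a A)
  then obtain q where q: "p = [:-a, 1:] * q"
    by (metis dvdE insertI1 poly_eq_0_iff_dvd)
  have "poly q b = 0" if "b \<in> A" for b
  proof -
    have "poly p b = 0" "b \<noteq> a" using insert that by auto
    then show ?thesis by (simp add: q)
  qed
  then have "rootp A dvd q" using insert.IH by blast
  then show ?case
    using insert by (simp add: rootp_def q mult_dvd_mono del: mult_pCons_left)
qed

definition lagrange :: "complex set \<Rightarrow> complex \<Rightarrow> complex poly" where
  "lagrange A a = smult (inverse (poly (rootp (A - {a})) a)) (rootp (A - {a}))"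

lemma poly_lagrange:
  assumes "finite A" "b \<in> A"
  shows "poly (lagrange A a) b = (if b = a then 1 else 0)"
  using assms by (auto simp: lagrange_def poly_rootp_eq_0_iff)

text \<open>Only the action of e(P), f(P), h(P) is retained. The twist is visible in
  \<open>X_Y\<close> alone, through D = \<open>rootp \<Delta>\<close>; the application has
  \<open>\<Delta> = {2, -2}\<close>. That \<open>v\<close> generates the module is a consequence of
  \<open>irreducible\<close>.\<close>

locale tw_simple_module = vector_space scale
  for scale :: "complex \<Rightarrow> 'v::ab_group_add \<Rightarrow> 'v" (infixr "\<cdot>" 75) +
  fixes X Y H :: "complex poly \<Rightarrow> 'v \<Rightarrow> 'v" and \<Delta> :: "complex set"
    and v :: 'v and \<psi> :: "complex poly \<Rightarrow> complex"
  assumes finite_\<Delta>: "finite \<Delta>"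
    and linear_X: "Vector_Spaces.linear (\<cdot>) (\<cdot>) (X P)"
    and linear_Y: "Vector_Spaces.linear (\<cdot>) (\<cdot>) (Y P)"
    and linear_H: "Vector_Spaces.linear (\<cdot>) (\<cdot>) (H P)"
    and Y_add: "Y (P + Q) u = Y P u + Y Q u"
    and Y_smult: "Y (smult c P) u = c \<cdot> Y P u"
    and H_add: "H (P + Q) u = H P u + H Q u"
    and H_smult: "H (smult c P) u = c \<cdot> H P u"
    and Y_Y: "Y P (Y Q u) = Y Q (Y P u)"
    and H_H: "H P (H Q u) = H Q (H P u)"
    and H_X: "H P (X Q u) = X Q (H P u) + 2 \<cdot> X (P * Q) u"
    and H_Y: "H P (Y Q u) = Y Q (H P u) - 2 \<cdot> Y (P * Q) u"
    and X_Y: "X P (Y Q u) = Y Q (X P u) + H (rootp \<Delta> * P * Q) u"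
    and irreducible: "\<lbrakk>subspace W; \<And>P u. u \<in> W \<Longrightarrow> X P u \<in> W; \<And>P u. u \<in> W \<Longrightarrow> Y P u \<in> W;
        \<And>P u. u \<in> W \<Longrightarrow> H P u \<in> W\<rbrakk> \<Longrightarrow> W = {0} \<or> W = UNIV"
    and v_nonzero: "v \<noteq> 0"
    and X_v: "X P v = 0"
    and H_v: "H P v = \<psi> P \<cdot> v"
begin

lemma linear_simps:
  assumes "Vector_Spaces.linear (\<cdot>) (\<cdot>) T"
  shows "T (x + y) = T x + T y" "T (c \<cdot> x) = c \<cdot> T x" "T 0 = 0" "T (x - y) = T x - T y"
proof -
  interpret T: module_hom "(\<cdot>)" "(\<cdot>)" T
    using assms by (rule Vector_Spaces.linear.axioms(3))
  show "T (x + y) = T x + T y" "T (c \<cdot> x) = c \<cdot> T x" "T 0 = 0" "T (x - y) = T x - T y"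
    by (fact T.add T.scale T.zero T.diff)+
qed

lemmas X_linear_simps = linear_simps[OF linear_X]
lemmas Y_linear_simps = linear_simps[OF linear_Y]
lemmas H_linear_simps = linear_simps[OF linear_H]

lemma linear_in_span:
  assumes "Vector_Spaces.linear (\<cdot>) (\<cdot>) T" "\<And>u. u \<in> B \<Longrightarrow> T u \<in> span C" "u \<in> span B"
  shows "T u \<in> span C"
  using assms(3)
proof (induction rule: span_induct_alt)
  case base
  then show ?case by (simp add: linear_simps[OF assms(1)] span_zero)
next
  case (step c x y)
  then show ?case
    using assms(2) by (simp add: linear_simps[OF assms(1)] span_add span_scale)
qed

lemma Y_0: "Y 0 u = 0" using Y_smult[of 0 0 u] by simp
lemma Y_diff: "Y (P - Q) u = Y P u - Y Q u"
  using Y_add[of "P - Q" Q u] by simp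
lemma Y_sum: "Y (sum f A) u = (\<Sum>a\<in>A. Y (f a) u)"
  by (induction A rule: infinite_finite_induct) (auto simp: Y_0 Y_add)

lemma \<psi>_add: "\<psi> (P + Q) = \<psi> P + \<psi> Q"
  using H_add[of P Q v] v_nonzero by (simp add: H_v flip: scale_left_distrib)
lemma \<psi>_smult: "\<psi> (smult c P) = c * \<psi> P"
  using H_smult[of c P v] v_nonzero by (simp add: H_v)
lemma \<psi>_0: "\<psi> 0 = 0" using \<psi>_smult[of 0 0] by simp
lemma \<psi>_sum: "\<psi> (sum f A) = (\<Sum>a\<in>A. \<psi> (f a))"
  by (induction A rule: infinite_finite_induct) (auto simp: \<psi>_0 \<psi>_add)
lemma \<psi>_diff: "\<psi> (P - Q) = \<psi> P - \<psi> Q"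
  using \<psi>_add[of "P - Q" Q] by simp

section \<open>Spanning by products of lowering operators\<close>

definition descendants :: "'v set \<Rightarrow> 'v set" where
  "descendants K = {foldr Y Ps u | Ps u. u \<in> K}"

lemma Y_descendants: "u \<in> descendants K \<Longrightarrow> Y P u \<in> descendants K"
proof -
  assume "u \<in> descendants K"
  then obtain Ps k where "u = foldr Y Ps k" "k \<in> K" by (auto simp: descendants_def)
  then show ?thesis
    unfolding descendants_def by (auto intro!: exI[of _ "P # Ps"] exI[of _ k])
qed

lemma descendants_superset: "K \<subseteq> descendants K"
  unfolding descendants_def by (force intro: exI[of _ "[]"])

lemma descendants_induct [consumes 1, case_names base Y]:
  assumes "u \<in> descendants K" "\<And>u. u \<in> K \<Longrightarrow> R u"
    "\<And>u P. u \<in> descendants K \<Longrightarrow> R u \<Longrightarrow> R (Y P u)"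
  shows "R u"
proof -
  have "R (foldr Y Ps k)" if "k \<in> K" for Ps k
  proof (induction Ps)
    case Nil
    then show ?case using assms(2) that by simp
  next
    case (Cons P Ps)
    then show ?case using assms(3) that by (auto simp: descendants_def)
  qed
  then show ?thesis
    using assms(1) by (auto simp: descendants_def)
qed

lemma Y_span_descendants: "u \<in> span (descendants K) \<Longrightarrow> Y P u \<in> span (descendants K)"
  by (rule linear_in_span[OF linear_Y]) (auto intro: span_base Y_descendants)

text \<open>A PBW-type argument: \<open>H P\<close> and \<open>X P\<close> can be moved past the
  \<open>Y\<close> factors at the cost of commutator terms that stay in the span, until they reach
  \<open>K\<close>. The span is therefore a nonzero submodule, and irreducibility applies.\<close>

lemma span_descendants_UNIV:
  assumes "\<And>P u. u \<in> K \<Longrightarrow> X P u = 0" "\<And>P u. u \<in> K \<Longrightarrow> H P u \<in> K"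
    and "k \<in> K" "k \<noteq> 0"
  shows "span (descendants K) = UNIV"
proof -
  have H: "H P u \<in> span (descendants K)" if "u \<in> descendants K" for P u
    using that
  proof (induction arbitrary: P rule: descendants_induct)
    case (base u)
    then show ?case using assms(2) descendants_superset span_base by blast
  next
    case (Y u Q)
    then show ?case
      by (simp add: H_Y span_diff span_scale span_base Y_descendants Y_span_descendants)
  qed
  have X: "X P u \<in> span (descendants K)" if "u \<in> descendants K" for P u
    using that
  proof (induction arbitrary: P rule: descendants_induct)
    case (base u)
    then show ?case by (simp add: assms(1) span_zero)
  next
    case (Y u Q)
    then show ?case
      by (simp add: X_Y span_add H Y_span_descendants)
  qed
  have "span (descendants K) = {0} \<or> span (descendants K) = UNIV"
    by (rule irreducible)
      (auto intro: linear_in_span[OF linear_X X] linear_in_span[OF linear_H H] Y_span_descendants)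
  moreover have "k \<in> span (descendants K)"
    using assms(3) descendants_superset span_base by blast
  ultimately show ?thesis using assms(4) by auto
qed

lemma span_descendants_v: "span (descendants {v}) = UNIV"
proof -
  \<comment> \<open>The set \<open>{v}\<close> need not be stable under \<open>H P\<close>, so the
    line through \<open>v\<close> is used first and then exchanged for \<open>{v}\<close>.\<close>
  have "span (descendants (span {v})) = UNIV"
  proof (rule span_descendants_UNIV)
    show "X P u = 0" if "u \<in> span {v}" for P u
      using that by (auto simp: span_singleton X_linear_simps X_v)
    show "H P u \<in> span {v}" if "u \<in> span {v}" for P u
      using that by (auto simp: span_singleton H_linear_simps H_v)
  qed (use v_nonzero in \<open>auto intro: span_base\<close>)
  moreover have "u \<in> span (descendants {v})" if "u \<in> descendants (span {v})" for u
    using that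
  proof (induction rule: descendants_induct)
    case (base u)
    then show ?case
      by (metis descendants_superset span_mono subset_iff)
  next
    case (Y u P)
    then show ?case by (simp add: Y_span_descendants)
  qed
  ultimately show ?thesis
    using span_minimal[of "descendants (span {v})" "span (descendants {v})"] by auto
qed

text \<open>Products of \<open>Y\<close> operators applied to \<open>v\<close> span the module, so
  an operator commuting with them is determined by its value at \<open>v\<close>. Vanishing is
  expressed as membership in \<open>span {}\<close>.\<close>

lemma zero_if_commutes:
  assumes "Vector_Spaces.linear (\<cdot>) (\<cdot>) T" "\<And>P u. T (Y P u) = Y P (T u)" "T v = 0"
  shows "T u = 0"
proof -
  have "T w \<in> span {}" if "w \<in> descendants {v}" for w
    using that by (induction rule: descendants_induct) (simp_all add: assms Y_linear_simps)
  then have "T u \<in> span {}"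
    using linear_in_span[OF assms(1)] span_descendants_v by blast
  then show ?thesis by simp
qed

section \<open>Weights with respect to \<open>H 1\<close>\<close>

text \<open>Each \<open>Y P\<close> lowers the eigenvalue of \<open>H 1\<close> by 2. This is the
  union of the lower eigenspaces, not a subspace; their sum is its \<open>span\<close>.\<close>

definition below :: "complex \<Rightarrow> 'v set" where
  "below c = {u. \<exists>k>0. H 1 u = (c - 2 * of_nat k) \<cdot> u}"

lemma eigenvector_not_in_span_below:
  assumes "u \<in> span (below c)" "H 1 u = c \<cdot> u"
  shows "u = 0"
proof -
  \<comment> \<open>For large \<open>n\<close> the product \<open>G n\<close> of the operators \<open>H 1 - (c - 2 k)\<close>, \<open>1 \<le> k \<le> n\<close>, kills \<open>u\<close>
      by the first assumption and multiplies it by a nonzero scalar by the second.\<close>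
  define F where "F k w = H 1 w - (c - 2 * of_nat k) \<cdot> w" for k w
  define G where "G n = foldr (\<lambda>k. F (Suc k)) [0..<n]" for n
  have F_add: "F k (a + b) = F k a + F k b" and F_scale: "F k (r \<cdot> a) = r \<cdot> F k a" for k a b r
    by (simp_all add: F_def H_linear_simps algebra_simps)
  have F_zero: "F k 0 = 0" for k by (simp add: F_def H_linear_simps)
  have G_Suc: "G (Suc n) w = G n (F (Suc n) w)" for n w by (simp add: G_def)
  have G_add: "G n (a + b) = G n a + G n b" for n a b
    by (induction n arbitrary: a b) (simp_all add: G_Suc F_add, simp add: G_def)
  have G_scale: "G n (r \<cdot> a) = r \<cdot> G n a" for n a r
    by (induction n arbitrary: a) (simp_all add: G_Suc F_scale, simp add: G_def)
  have G_zero: "G n 0 = 0" for n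
    by (induction n) (simp_all add: G_Suc F_zero, simp add: G_def)
  have G_eigen: "G n w = (\<Prod>k<n. d - c + 2 * of_nat (Suc k)) \<cdot> w" if "H 1 w = d \<cdot> w" for n w d
    using that
  proof (induction n)
    case 0
    then show ?case by (simp add: G_def)
  next
    case (Suc n)
    have "F (Suc n) w = (d - c + 2 * of_nat (Suc n)) \<cdot> w"
      using Suc.prems by (simp add: F_def algebra_simps)
    then show ?case using Suc by (simp add: G_Suc G_scale mult.commute)
  qed
  have G_below: "\<exists>n. \<forall>m\<ge>n. G m w = 0" if "w \<in> below c" for w
  proof -
    obtain k where k: "k > 0" "H 1 w = (c - 2 * of_nat k) \<cdot> w"
      using \<open>w \<in> below c\<close> by (auto simp: below_def)
    show ?thesis
    proof (intro exI allI impI)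
      fix m assume "m \<ge> k"
      \<comment> \<open>The factor with j = k - 1 is zero, because \<open>Suc j = k\<close>.\<close>
      then have "(\<Prod>j<m. (c - 2 * of_nat k) - c + 2 * of_nat (Suc j) :: complex) = 0"
        using k(1) by (intro prod_zero) (auto intro!: bexI[of _ "k - 1"])
      then show "G m w = 0" using G_eigen[OF k(2), of m] by simp
    qed
  qed
  have "\<exists>n. \<forall>m\<ge>n. G m u = 0"
    using assms(1)
  proof (induction rule: span_induct_alt)
    case base
    then show ?case by (simp add: G_zero)
  next
    case (step r a b)
    obtain n n' where "\<forall>m\<ge>n. G m a = 0" "\<forall>m\<ge>n'. G m b = 0"
      using G_below[OF step(1)] step(2) by blast
    then show ?case
      by (intro exI[of _ "max n n'"]) (simp add: G_add G_scale)
  qed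
  then obtain n where "G n u = 0" by blast
  moreover have "(\<Prod>k<n. 2 * of_nat (Suc k) :: complex) \<noteq> 0"
    by (simp add: prod_zero_iff del: of_nat_Suc)
  ultimately show ?thesis
    using G_eigen[OF assms(2), of n] by simp
qed

text \<open>A nonzero such vector would generate the whole module by lowering operators alone, so
  the module would be spanned by vectors of weight strictly below \<open>\<psi> 1\<close>; but
  \<open>v\<close> has weight \<open>\<psi> 1\<close>.\<close>

lemma singular_vector_zero:
  assumes "\<And>P. X P u = 0" "u \<in> below (\<psi> 1)"
  shows "u = 0"
proof (rule ccontr)
  assume "u \<noteq> 0"
  \<comment> \<open>All singular vectors of lower weight are taken together, since the set fed into
    \<open>span_descendants_UNIV\<close> must be stable under every \<open>H P\<close>.\<close>
  define K where "K = {u \<in> below (\<psi> 1). \<forall>P. X P u = 0}"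
  have K_H: "H P w \<in> K" if "w \<in> K" for P w
  proof -
    have "H 1 (H P w) = H P (H 1 w)" by (rule H_H)
    moreover have "X Q (H P w) = 0" for Q
      using H_X[of P Q w] that by (simp add: K_def H_linear_simps)
    ultimately show ?thesis
      using that by (auto simp: K_def below_def H_linear_simps)
  qed
  have "span (descendants K) = UNIV"
    using assms \<open>u \<noteq> 0\<close> K_H by (intro span_descendants_UNIV[of _ u]) (auto simp: K_def)
  moreover have "w \<in> below (\<psi> 1)" if "w \<in> descendants K" for w
    using that
  proof (induction rule: descendants_induct)
    case (base w)
    then show ?case by (simp add: K_def)
  next
    case (Y w P)
    then obtain k where k: "H 1 w = (\<psi> 1 - 2 * of_nat k) \<cdot> w" by (auto simp: below_def)
    have "H 1 (Y P w) = (\<psi> 1 - 2 * of_nat (Suc k)) \<cdot> Y P w"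
      by (simp add: H_Y k Y_linear_simps algebra_simps)
    then show ?case unfolding below_def by blast
  qed
  ultimately have "v \<in> span (below (\<psi> 1))"
    by (metis UNIV_I span_mono subsetI subset_iff)
  then show False
    using eigenvector_not_in_span_below H_v v_nonzero by blast
qed

section \<open>Strings of powers of a lowering operator\<close>

lemma Y_power_commute: "(Y P ^^ n) (Y Q u) = Y Q ((Y P ^^ n) u)"
  by (induction n) (simp_all add: Y_Y[of P Q])

lemma Y_power_weight: "H 1 ((Y P ^^ n) v) = (\<psi> 1 - 2 * of_nat n) \<cdot> (Y P ^^ n) v"
proof (induction n)
  case 0
  then show ?case by (simp add: H_v)
next
  case (Suc n)
  then show ?case by (simp add: H_Y Y_linear_simps) (simp add: algebra_simps)
qed

text \<open>\<open>X Q\<close> sends \<open>Y P v\<close> to the multiple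
  \<open>\<psi> (rootp \<Delta> * P * Q)\<close> of \<open>v\<close>, so the assumption makes
  \<open>Y P v\<close> a singular vector one step below \<open>v\<close>.\<close>

lemma Y_v_zero:
  assumes "\<And>Q. \<psi> (rootp \<Delta> * P * Q) = 0"
  shows "Y P v = 0"
proof (rule singular_vector_zero)
  show "X Q (Y P v) = 0" for Q
    using assms[of Q] by (simp add: X_Y X_v Y_linear_simps H_v ac_simps)
  show "Y P v \<in> below (\<psi> 1)"
    using Y_power_weight[of 1 P] by (auto simp: below_def intro!: exI[of _ 1])
qed

text \<open>An \<open>sl_2\<close> string computation. By commutativity the assumption carries over
  from \<open>v\<close> to the whole string, so \<open>H (rootp \<Delta> * Q * P)\<close> acts on
  its n-th vector by c - 2 \<kappa> n. Summing these eigenvalues from 0 to n gives (n + 1) (c -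
  \<kappa> n).\<close>

lemma string_action:
  fixes n :: nat
  assumes "Y (rootp \<Delta> * Q * P * P) v = \<kappa> \<cdot> Y P v"
  defines "c \<equiv> \<psi> (rootp \<Delta> * Q * P)"
  shows "X Q ((Y P ^^ Suc n) v) = (of_nat (Suc n) * (c - \<kappa> * of_nat n)) \<cdot> (Y P ^^ n) v"
proof -
  let ?R = "rootp \<Delta> * Q * P"
  have Y: "Y (?R * P) ((Y P ^^ n) v) = \<kappa> \<cdot> (Y P ^^ Suc n) v" for n
    using assms(1) by (induction n) (simp_all add: Y_Y[of "?R * P" P] Y_linear_simps)
  have H: "H ?R ((Y P ^^ n) v) = (c - 2 * \<kappa> * of_nat n) \<cdot> (Y P ^^ n) v" for n
  proof (induction n)
    case 0
    then show ?case by (simp add: H_v c_def)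
  next
    case (Suc n)
    then show ?case
      using Y[of n] by (simp add: H_Y Y_linear_simps) (simp add: algebra_simps)
  qed
  show ?thesis
  proof (induction n)
    case 0
    then show ?case by (simp add: X_Y X_v Y_linear_simps H_v c_def)
  next
    case (Suc n)
    have "X Q ((Y P ^^ Suc (Suc n)) v) = Y P (X Q ((Y P ^^ Suc n) v)) + H ?R ((Y P ^^ Suc n) v)"
      by (simp add: X_Y)
    also have "\<dots> = (of_nat (Suc n) * (c - \<kappa> * of_nat n)) \<cdot> (Y P ^^ Suc n) v
        + (c - 2 * \<kappa> * of_nat (Suc n)) \<cdot> (Y P ^^ Suc n) v"
      unfolding Suc.IH H by (simp add: Y_linear_simps)
    also have "\<dots> = (of_nat (Suc (Suc n)) * (c - \<kappa> * of_nat (Suc n))) \<cdot> (Y P ^^ Suc n) v"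
      unfolding scale_left_distrib[symmetric]
      by (rule arg_cong2[of _ _ _ _ scale]) (auto simp: algebra_simps)
    finally show ?case .
  qed
qed

lemma linear_Y_power: "Vector_Spaces.linear (\<cdot>) (\<cdot>) (Y P ^^ n)"
proof (induction n)
  case 0
  then show ?case
    by (simp add: Vector_Spaces.linear_iff vector_space_axioms)
next
  case (Suc n)
  then show ?case
    by (simp add: Vector_Spaces.linear_iff Y_linear_simps)
qed

section \<open>From the weight formula to finite dimension\<close>

text \<open>Operators are adjoined one by one: all powers of the new one up to its nilpotency index
  are applied to the old spanning set. Commutativity preserves invariance under the earlier
  operators.\<close>

lemma finite_Y_invariant_span:
  assumes "finite \<P>" "\<And>P. P \<in> \<P> \<Longrightarrow> \<exists>n. (Y P ^^ n) v = 0"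
  shows "\<exists>B. finite B \<and> v \<in> span B \<and> (\<forall>P\<in>\<P>. \<forall>b\<in>B. Y P b \<in> span B)"
  using assms
proof (induction \<P> rule: finite_induct)
  case empty
  then show ?case by (intro exI[of _ "{v}"]) (simp add: span_base)
next
  case (insert P \<P>)
  then obtain B where B: "finite B" "v \<in> span B" "\<And>Q b. \<lbrakk>Q \<in> \<P>; b \<in> B\<rbrakk> \<Longrightarrow> Y Q b \<in> span B"
    by blast
  obtain n where "(Y P ^^ n) v = 0" using insert.prems by blast
  \<comment> \<open>Nilpotency at \<open>v\<close> spreads to the whole module, since the power
    commutes with every \<open>Y Q\<close>.\<close>
  then have n: "(Y P ^^ n) u = 0" for u
    using zero_if_commutes[OF linear_Y_power Y_power_commute] by blast
  define C where "C = (\<lambda>(k, b). (Y P ^^ k) b) ` ({..n} \<times> B)"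
  have C: "(Y P ^^ k) b \<in> span C" if "b \<in> B" "k \<le> n" for k b
    using that unfolding C_def by (intro span_base) auto
  have power: "(Y P ^^ k) w \<in> span C" if "w \<in> span B" "k \<le> n" for k w
    using linear_in_span[OF linear_Y_power] C that by blast
  have "finite C" using B(1) by (simp add: C_def)
  moreover have "v \<in> span C" using power[OF B(2), of 0] by simp
  moreover have "Y Q c \<in> span C" if Q: "Q \<in> insert P \<P>" and "c \<in> C" for Q c
  proof -
    obtain k b where kb: "k \<le> n" "b \<in> B" "c = (Y P ^^ k) b"
      using \<open>c \<in> C\<close> by (auto simp: C_def)
    show ?thesis
    proof (cases "Q \<in> \<P>")
      case True
      then show ?thesis
        using power[OF B(3) kb(1)] kb by (simp flip: Y_power_commute)
    next
      case False
      then have "Y Q c = (Y P ^^ Suc k) b" using Q kb by simp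
      moreover have "(Y P ^^ Suc k) b = 0" if "k = n"
        using n[of b] that by (simp add: Y_linear_simps)
      ultimately show ?thesis
        using C[of b "Suc k"] kb by (cases "k = n") (auto simp: span_zero simp del: funpow.simps)
    qed
  qed
  ultimately show ?case by blast
qed

lemma finite_span_if_weight:
  assumes "finite \<Lambda>" "\<Lambda> \<inter> \<Delta> = {}"
    and \<psi>: "\<And>P. \<psi> P = (\<Sum>\<mu>\<in>\<Delta>. \<nu> \<mu> * poly P \<mu>) + (\<Sum>\<beta>\<in>\<Lambda>. of_nat (m \<beta>) * poly P \<beta>)"
  shows "\<exists>B. finite B \<and> span B = UNIV"
proof -
  have \<psi>_D: "\<psi> (rootp \<Delta> * P) = (\<Sum>\<beta>\<in>\<Lambda>. of_nat (m \<beta>) * (poly (rootp \<Delta>) \<beta> * poly P \<beta>))" for P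
  proof -
    have "(\<Sum>\<mu>\<in>\<Delta>. \<nu> \<mu> * poly (rootp \<Delta> * P) \<mu>) = 0"
      using finite_\<Delta> by (intro sum.neutral) (simp add: poly_rootp_eq_0_iff)
    then show ?thesis by (simp add: \<psi>)
  qed
  \<comment> \<open>Multiplying by D removes the evaluations at \<Delta>, so \<open>Y P v\<close>
    depends only on the values of \<open>P\<close> on \<Lambda>.\<close>
  have Y_zero: "Y P v = 0" if "\<And>\<beta>. \<beta> \<in> \<Lambda> \<Longrightarrow> poly P \<beta> = 0" for P
    using that by (intro Y_v_zero) (simp add: \<psi>_D mult.assoc)
  have nilpotent: "(Y (lagrange \<Lambda> \<beta>) ^^ Suc (m \<beta>)) v = 0" if "\<beta> \<in> \<Lambda>" for \<beta>
  proof (rule singular_vector_zero)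
    let ?P = "lagrange \<Lambda> \<beta>"
    fix Q
    \<comment> \<open>On \<Lambda> the polynomial \<open>?P\<close> is the indicator of \<beta>, so
      D Q ?P ?P and \<kappa> ?P take the same values there. The factor c - \<kappa> n of
      \<open>string_action\<close> becomes \<kappa> (m \<beta> - n), which is zero at n = m \<beta>
      for every \<open>Q\<close>; hence the exponent \<open>Suc (m \<beta>)\<close>.\<close>
    define \<kappa> where "\<kappa> = poly (rootp \<Delta> * Q) \<beta>"
    have "Y (rootp \<Delta> * Q * ?P * ?P - smult \<kappa> ?P) v = 0"
      using assms(1) by (intro Y_zero) (simp add: poly_lagrange \<kappa>_def)
    moreover have "\<psi> (rootp \<Delta> * Q * ?P) = \<kappa> * of_nat (m \<beta>)"
    proof -
      have "\<psi> (rootp \<Delta> * Q * ?P) = (\<Sum>a\<in>\<Lambda>. if a = \<beta> then \<kappa> * of_nat (m \<beta>) else 0)"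
        unfolding mult.assoc \<psi>_D using assms(1)
        by (intro sum.cong) (auto simp: poly_lagrange \<kappa>_def)
      then show ?thesis using assms(1) that by simp
    qed
    ultimately show "X Q ((Y ?P ^^ Suc (m \<beta>)) v) = 0"
      using string_action[of Q ?P \<kappa> "m \<beta>"] by (simp add: Y_diff Y_smult)
  next
    show "(Y (lagrange \<Lambda> \<beta>) ^^ Suc (m \<beta>)) v \<in> below (\<psi> 1)"
      unfolding below_def using Y_power_weight by blast
  qed
  then obtain B where B: "finite B" "v \<in> span B"
    "\<And>\<beta> b. \<lbrakk>\<beta> \<in> \<Lambda>; b \<in> B\<rbrakk> \<Longrightarrow> Y (lagrange \<Lambda> \<beta>) b \<in> span B"
    using finite_Y_invariant_span[of "lagrange \<Lambda> ` \<Lambda>"] assms(1) by blast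
  have Y_B: "Y P b \<in> span B" if "b \<in> B" for P b
  proof -
    \<comment> \<open>The interpolation remainder acts by zero, so every \<open>Y P\<close> is a
      combination of the finitely many Lagrange operators.\<close>
    let ?R = "P - (\<Sum>\<beta>\<in>\<Lambda>. smult (poly P \<beta>) (lagrange \<Lambda> \<beta>))"
    have "Y ?R v = 0"
    proof (rule Y_zero)
      fix \<mu> assume "\<mu> \<in> \<Lambda>"
      then have "(\<Sum>\<beta>\<in>\<Lambda>. poly P \<beta> * poly (lagrange \<Lambda> \<beta>) \<mu>) = (\<Sum>\<beta>\<in>\<Lambda>. if \<mu> = \<beta> then poly P \<beta> else 0)"
        using assms(1) by (intro sum.cong) (auto simp: poly_lagrange)
      then show "poly ?R \<mu> = 0"
        using assms(1) \<open>\<mu> \<in> \<Lambda>\<close> by (simp add: poly_sum)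
    qed
    then have "Y ?R b = 0" using zero_if_commutes[OF linear_Y Y_Y] by blast
    then have "Y P b = (\<Sum>\<beta>\<in>\<Lambda>. poly P \<beta> \<cdot> Y (lagrange \<Lambda> \<beta>) b)"
      by (simp add: Y_diff Y_sum Y_smult)
    then show ?thesis
      using B(3) that by (simp add: span_sum span_scale)
  qed
  have "u \<in> span B" if "u \<in> descendants {v}" for u
    using that
    by (induction rule: descendants_induct) (auto simp: B(2) intro: linear_in_span[OF linear_Y Y_B])
  then have "span (descendants {v}) \<subseteq> span B" by (intro span_minimal) auto
  then show ?thesis using span_descendants_v B(1) by auto
qed

section \<open>From finite dimension to the weight formula\<close>

text \<open>If no coefficient were zero, applying \<open>X Q\<close> would show that every vector of
  the string is nonzero. Their weights are distinct, so they would form an infinite independent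
  family.\<close>

lemma string_terminates:
  assumes "finite B" "span B = UNIV"
    and step: "\<And>n. X Q ((Y P ^^ Suc n) v) = d n \<cdot> (Y P ^^ n) v"
  shows "\<exists>n. d n = 0"
proof (rule ccontr)
  assume "\<nexists>n. d n = 0"
  define f where "f n = (Y P ^^ n) v" for n
  have f: "f n \<noteq> 0" for n
  proof (induction n)
    case 0
    then show ?case by (simp add: f_def v_nonzero)
  next
    case (Suc n)
    moreover have "X Q (f (Suc n)) = d n \<cdot> f n" using step by (simp add: f_def)
    ultimately show ?case
      using \<open>\<nexists>n. d n = 0\<close> by (metis X_linear_simps(3) scale_eq_0_iff)
  qed
  have weight: "H 1 (f n) = (\<psi> 1 - 2 * of_nat n) \<cdot> f n" for n
    unfolding f_def by (rule Y_power_weight)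
  have notin: "f n \<notin> span (f ` {Suc n..<n'})" for n n'
  proof
    assume "f n \<in> span (f ` {Suc n..<n'})"
    moreover have "f ` {Suc n..<n'} \<subseteq> below (\<psi> 1 - 2 * of_nat n)"
    proof
      fix u assume "u \<in> f ` {Suc n..<n'}"
      then obtain k where k: "n < k" "u = f k" by (auto simp: Suc_le_eq)
      then have "H 1 u = (\<psi> 1 - 2 * of_nat n - 2 * of_nat (k - n)) \<cdot> u"
        by (simp add: weight of_nat_diff algebra_simps)
      then show "u \<in> below (\<psi> 1 - 2 * of_nat n)"
        unfolding below_def using k(1) by (auto intro!: exI[of _ "k - n"])
    qed
    ultimately have "f n \<in> span (below (\<psi> 1 - 2 * of_nat n))"
      using span_mono by blast
    then show False using eigenvector_not_in_span_below weight f by blast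
  qed
  \<comment> \<open>The induction puts the vector of highest weight in front of a shorter segment,
    so the starting index has to vary.\<close>
  have independent: "independent (f ` {n..<n + k}) \<and> card (f ` {n..<n + k}) = k" for n k
  proof (induction k arbitrary: n)
    case 0
    then show ?case by (simp add: independent_empty)
  next
    case (Suc k)
    have "{n..<n + Suc k} = insert n {Suc n..<Suc n + k}" by auto
    moreover have "f n \<notin> f ` {Suc n..<Suc n + k}"
      using notin span_base by blast
    ultimately show ?case
      using Suc[of "Suc n"] notin[of n "Suc n + k"] by (simp add: independent_insertI)
  qed
  have "card (f ` {0..<0 + Suc (card B)}) \<le> card B"
    using independent_span_bound[OF assms(1)] independent assms(2) by blast
  then show False using independent[of 0 "Suc (card B)"] by simp
qed

text \<open>The linear map taking \<open>P\<close> to \<open>Y P v\<close> starts from an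
  infinite-dimensional space. Were it injective, the first \<open>card B + 1\<close> monomials would
  have independent images.\<close>

lemma ex_annihilating_poly:
  assumes "finite B" "span B = UNIV"
  shows "\<exists>P. P \<noteq> 0 \<and> Y P v = 0"
proof (rule ccontr)
  assume "\<nexists>P. P \<noteq> 0 \<and> Y P v = 0"
  then have inj: "P = 0" if "Y P v = 0" for P using that by blast
  define f where "f n = Y (monom 1 n) v" for n
  have "inj f"
  proof (rule injI)
    fix i j assume "f i = f j"
    then have "monom (1::complex) i - monom 1 j = 0"
      by (intro inj) (simp add: f_def Y_diff)
    then show "i = j" by (simp add: monom_eq_iff')
  qed
  have "independent (f ` {..card B})"
  proof
    assume "dependent (f ` {..card B})"
    then obtain r where r: "\<exists>i\<le>card B. r (f i) \<noteq> 0" "(\<Sum>u\<in>f ` {..card B}. r u \<cdot> u) = 0"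
      by (auto simp: dependent_finite)
    have "Y (\<Sum>i\<le>card B. monom (r (f i)) i) v = (\<Sum>i\<le>card B. r (f i) \<cdot> f i)"
      by (simp add: Y_sum f_def flip: Y_smult) (simp add: smult_monom)
    also have "\<dots> = 0"
      using r(2) \<open>inj f\<close> by (subst (asm) sum.reindex) (auto intro: inj_on_subset)
    finally have "(\<Sum>i\<le>card B. monom (r (f i)) i) = 0" by (rule inj)
    then have "coeff (\<Sum>i\<le>card B. monom (r (f i)) i) j = 0" for j by simp
    from this[unfolded coeff_sum] have "r (f j) = 0" if "j \<le> card B" for j
      using that by (simp split: if_splits) metis
    then show False using r(1) by blast
  qed
  then have "card (f ` {..card B}) \<le> card B"
    using independent_span_bound[OF assms(1)] assms(2) by blast
  moreover have "card (f ` {..card B}) = Suc (card B)"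
    using \<open>inj f\<close> by (simp add: card_image inj_on_subset)
  ultimately show False by simp
qed

lemma weight_if_finite_span:
  assumes "finite B" "span B = UNIV"
  shows "\<exists>\<Lambda> m \<nu>. finite \<Lambda> \<and> \<Lambda> \<inter> \<Delta> = {} \<and>
    (\<forall>P. \<psi> P = (\<Sum>\<mu>\<in>\<Delta>. \<nu> \<mu> * poly P \<mu>) + (\<Sum>\<beta>\<in>\<Lambda>. of_nat (m \<beta>) * poly P \<beta>))"
proof -
  \<comment> \<open>The largest ideal contained in the kernel of \<psi>.\<close>
  define J where "J = {R. \<forall>P. \<psi> (R * P) = 0}"
  have J_dvd: "R \<in> J" if "S \<in> J" "S dvd R" for R S
    using that by (auto simp: J_def mult.assoc elim!: dvdE)
  have Y_J: "Y P v = 0" if "rootp \<Delta> * P \<in> J" for P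
    using that by (intro Y_v_zero) (simp add: J_def)
  obtain P where P: "P \<noteq> 0" "Y P v = 0"
    using ex_annihilating_poly[OF assms] by blast
  define \<Omega> where "\<Omega> = {z. poly (rootp \<Delta> * P) z = 0}"
  define S where "S = rootp \<Omega>"
  have D_nonzero: "rootp \<Delta> \<noteq> 0"
    by (simp add: rootp_def prod_zero_iff finite_\<Delta>)
  then have "finite \<Omega>" unfolding \<Omega>_def using P(1) by (intro poly_roots_finite) simp
  have "\<Delta> \<subseteq> \<Omega>" using finite_\<Delta> by (auto simp: \<Omega>_def poly_rootp_eq_0_iff)
  have S_dvd: "S dvd R" if "\<And>z. z \<in> \<Omega> \<Longrightarrow> poly R z = 0" for R
    using that \<open>finite \<Omega>\<close> unfolding S_def by (intro rootp_dvd)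
  have D_J: "rootp \<Delta> * P \<in> J"
  proof -
    have "\<psi> (rootp \<Delta> * P * Q) = 0" for Q
    proof -
      have "\<psi> (rootp \<Delta> * P * Q) \<cdot> v = X Q (Y P v)"
        by (simp only: X_Y X_v Y_linear_simps H_v) (simp add: ac_simps)
      then show ?thesis using P(2) v_nonzero by (simp add: X_linear_simps)
    qed
    then show ?thesis by (simp add: J_def)
  qed
  \<comment> \<open>\<open>S\<close> is the squarefree polynomial with the roots of D P, so the
    Nullstellensatz makes one of its powers a multiple of D P.\<close>
  have "rootp \<Delta> * P dvd S ^ degree (rootp \<Delta> * P)"
    using nullstellensatz_univariate[of "rootp \<Delta> * P" S] P(1) D_nonzero \<open>finite \<Omega>\<close>
    by (auto simp: S_def poly_rootp_eq_0_iff \<Omega>_def)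
  then have S_power: "\<exists>k. S ^ k \<in> J" using J_dvd[OF D_J] by blast
  have "S \<in> J"
  proof (rule ccontr)
    assume "S \<notin> J"
    \<comment> \<open>With k minimal and at least 2, choose \<open>R\<close> with D R = S^(k-1) Q
      and \<psi>(D R) nonzero. Then D (D R R) is a multiple of S^(2k-2), hence lies in
      \<open>J\<close>, so \<open>string_action\<close> applies with \<kappa> = 0. Its coefficients
      (n + 1) \<psi>(D R) never vanish, contradicting termination.\<close>
    define k where "k = (LEAST k. S ^ k \<in> J)"
    have "S ^ k \<in> J" unfolding k_def using S_power by (rule LeastI_ex)
    moreover have "S ^ 0 \<notin> J" "S ^ 1 \<notin> J"
      using \<open>S \<notin> J\<close> J_dvd[of 1 S] by auto
    ultimately have "k \<noteq> 0" "k \<noteq> 1" by metis+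
    then obtain j where k: "k = Suc (Suc j)" by (metis One_nat_def not0_implies_Suc)
    then have "S ^ Suc j \<notin> J"
      unfolding k_def using not_less_Least by (metis lessI)
    then obtain Q where Q: "\<psi> (S ^ Suc j * Q) \<noteq> 0" by (auto simp: J_def)
    have "rootp \<Delta> dvd S"
      using finite_\<Delta> \<open>\<Delta> \<subseteq> \<Omega>\<close> \<open>finite \<Omega>\<close> unfolding S_def
      by (intro rootp_dvd) (auto simp: poly_rootp_eq_0_iff)
    then obtain T where T: "S = rootp \<Delta> * T" by (rule dvdE)
    define R where "R = T * S ^ j * Q"
    have DR: "rootp \<Delta> * R = S ^ Suc j * Q" by (simp add: R_def T ac_simps)
    have "rootp \<Delta> * (rootp \<Delta> * 1 * R * R) = (rootp \<Delta> * R) * (rootp \<Delta> * R)"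
      by (simp add: ac_simps)
    also have "\<dots> = S ^ k * (S ^ j * Q * Q)"
      unfolding DR k by (simp add: ac_simps)
    finally have "rootp \<Delta> * (rootp \<Delta> * 1 * R * R) \<in> J"
      using J_dvd[OF \<open>S ^ k \<in> J\<close>] by simp
    then have "Y (rootp \<Delta> * 1 * R * R) v = 0 \<cdot> Y R v" by (simp only: Y_J scale_zero_left)
    from string_terminates[OF assms string_action[OF this]] show False
      using Q DR by (simp del: of_nat_Suc)
  qed
  define E where "E = lagrange \<Omega>"
  have E: "poly (E \<beta>) z = (if z = \<beta> then 1 else 0)" if "z \<in> \<Omega>" for \<beta> z
    using poly_lagrange[OF \<open>finite \<Omega>\<close> that] by (simp add: E_def)
  have \<psi>: "\<psi> P = (\<Sum>\<beta>\<in>\<Omega>. \<psi> (E \<beta>) * poly P \<beta>)" for P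
  proof -
    \<comment> \<open>The interpolation remainder vanishes on \<Omega>, so it is a multiple of
      \<open>S\<close> and \<psi> kills it.\<close>
    let ?R = "P - (\<Sum>\<beta>\<in>\<Omega>. smult (poly P \<beta>) (E \<beta>))"
    have "poly ?R z = 0" if "z \<in> \<Omega>" for z
    proof -
      have "(\<Sum>\<beta>\<in>\<Omega>. poly P \<beta> * poly (E \<beta>) z) = (\<Sum>\<beta>\<in>\<Omega>. if z = \<beta> then poly P \<beta> else 0)"
        using that by (intro sum.cong) (auto simp: E)
      then show ?thesis using \<open>finite \<Omega>\<close> that by (simp add: poly_sum)
    qed
    then have "?R \<in> J" using J_dvd[OF \<open>S \<in> J\<close> S_dvd] by blast
    then have "\<psi> (?R * 1) = 0" unfolding J_def by blast
    then show ?thesis by (simp add: \<psi>_diff \<psi>_sum \<psi>_smult mult.commute)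
  qed
  \<comment> \<open>Away from \<Delta> the Lagrange polynomial is D R for some \<open>R\<close>, and
    it is idempotent modulo \<open>J\<close>. This is the case \<kappa> = 1, with coefficients (n +
    1) (\<psi>(E \<beta>) - n); a vanishing one identifies the value with a natural number.\<close>
  have "\<exists>n. \<psi> (E \<beta>) = of_nat n" if "\<beta> \<in> \<Omega> - \<Delta>" for \<beta>
  proof -
    have "rootp \<Delta> dvd E \<beta>"
      using finite_\<Delta> \<open>\<Delta> \<subseteq> \<Omega>\<close> that by (intro rootp_dvd) (auto simp: E)
    then obtain R where R: "E \<beta> = rootp \<Delta> * R" by (rule dvdE)
    have "rootp \<Delta> * (rootp \<Delta> * 1 * R * R - R) = E \<beta> * E \<beta> - E \<beta>"
      by (simp add: R algebra_simps)
    also have "\<dots> \<in> J"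
      using J_dvd[OF \<open>S \<in> J\<close> S_dvd] by (simp add: E)
    finally have "Y (rootp \<Delta> * 1 * R * R - R) v = 0" by (rule Y_J)
    then have "Y (rootp \<Delta> * 1 * R * R) v = 1 \<cdot> Y R v"
      unfolding Y_diff by simp
    from string_terminates[OF assms string_action[OF this]] show ?thesis
      by (auto simp: R simp del: of_nat_Suc)
  qed
  then obtain m where m: "\<And>\<beta>. \<beta> \<in> \<Omega> - \<Delta> \<Longrightarrow> \<psi> (E \<beta>) = of_nat (m \<beta>)" by metis
  show ?thesis
  proof (intro exI conjI allI)
    show "\<psi> P = (\<Sum>\<mu>\<in>\<Delta>. \<psi> (E \<mu>) * poly P \<mu>) + (\<Sum>\<beta>\<in>\<Omega> - \<Delta>. of_nat (m \<beta>) * poly P \<beta>)" for P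
      unfolding \<psi>[of P] sum.subset_diff[OF \<open>\<Delta> \<subseteq> \<Omega>\<close> \<open>finite \<Omega>\<close>]
      by (simp add: m add.commute)
  qed (use \<open>finite \<Omega>\<close> in auto)
qed

end

section \<open>Polynomial coordinates on the twisted loop algebra\<close>

lemma laurent_induct [case_names single add]:
  fixes p :: "'a \<Rightarrow>\<^sub>0 'b::monoid_add"
  assumes "\<And>k c. R (Poly_Mapping.single k c)" "\<And>p q. R p \<Longrightarrow> R q \<Longrightarrow> R (p + q)"
  shows "R p"
proof (induction p rule: Poly_Mapping.update_induct)
  case const
  show ?case using assms(1)[of undefined 0] by simp
next
  case (update p k c)
  then have "Poly_Mapping.update k c p = p + Poly_Mapping.single k c"
    by (intro poly_mapping_eqI)
      (auto simp: lookup_update lookup_add lookup_single when_def in_keys_iff)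
  then show ?case using update assms by simp
qed

abbreviation flip :: "laurent \<Rightarrow> laurent" where
  "flip \<equiv> Poly_Mapping.map_key uminus"

lemma flip_add: "flip (p + q) = flip p + flip q"
  by (rule map_key_plus) simp

lemma flip_mult: "flip (p * q) = flip p * flip q"
proof (induction p rule: laurent_induct)
  case (single k c)
  show ?case
    by (induction q rule: laurent_induct)
      (simp_all add: mult_single map_key_uminus_single flip_add distrib_left)
next
  case (add p p')
  then show ?case by (simp add: flip_add distrib_right)
qed

lemma flip_diff: "flip (p - q) = flip p - flip q"
  using flip_add[of "p - q" q] by simp

lemma flip_uminus: "flip (- p) = - flip p"
  using flip_diff[of 0 p] by simp

lemma flip_tplus: "flip tplus = tplus"
  by (simp add: tplus_def flip_add map_key_uminus_single)

lemma flip_tminus: "flip tminus = - tminus"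
  by (simp add: tminus_def flip_diff map_key_uminus_single)

definition subst_tplus :: "complex poly \<Rightarrow> laurent" where
  "subst_tplus P = poly (map_poly (Poly_Mapping.single 0) P) tplus"

lemma subst_0 [simp]: "subst_tplus 0 = 0"
  by (simp add: subst_tplus_def)

lemma subst_pCons [simp]:
  "subst_tplus (pCons c P) = Poly_Mapping.single 0 c + tplus * subst_tplus P"
  by (simp add: subst_tplus_def map_poly_pCons)

lemma subst_1 [simp]: "subst_tplus 1 = 1"
  by (simp add: one_pCons)

lemma subst_add: "subst_tplus (P + Q) = subst_tplus P + subst_tplus Q"
  by (induction P Q rule: poly_induct2) (simp_all add: single_add algebra_simps)

lemma subst_smult: "subst_tplus (smult c P) = Poly_Mapping.single 0 c * subst_tplus P"
  by (induction P) (simp_all add: mult_single algebra_simps)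

lemma subst_mult: "subst_tplus (P * Q) = subst_tplus P * subst_tplus Q"
  by (induction P) (simp_all add: subst_add subst_smult algebra_simps)

lemma subst_monom: "subst_tplus (monom c n) = Poly_Mapping.single 0 c * tplus ^ n"
  by (induction n) (simp_all add: monom_0 monom_Suc ac_simps)

lemma flip_subst: "flip (subst_tplus P) = subst_tplus P"
  by (induction P) (simp_all add: flip_add flip_mult flip_tplus map_key_uminus_single)

text \<open>The origin of D: the square of t - 1/t is the square of t + 1/t minus 4. Its roots 2 and
  -2 are the values of t + 1/t at t = 1 and t = -1.\<close>

lemma tminus_squared: "tminus * tminus = subst_tplus (rootp {2, -2})"
proof -
  have "rootp {2, -2} = [:-4, 0, 1:]" by (simp add: rootp_def)
  moreover have "Poly_Mapping.single (0::int) (-4 :: complex) = -4" by (simp add: single_uminus)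
  ultimately show ?thesis
    by (simp add: tplus_def tminus_def algebra_simps mult_single)
qed

lemma half_double: "Poly_Mapping.single 0 (1/2) * (p + p) = (p :: laurent)"
proof -
  have "Poly_Mapping.single 0 (1/2) * (p + p) =
      (Poly_Mapping.single 0 (1/2) + Poly_Mapping.single 0 (1/2)) * p"
    by (simp only: distrib_left distrib_right)
  also have "\<dots> = p" unfolding single_add[symmetric] by simp
  finally show ?thesis .
qed

text \<open>The sums t^n + t^(-n) are polynomials in t + 1/t by the Chebyshev recurrence: t + 1/t
  times one term, minus the preceding term, gives the next.\<close>

lemma symmetric_laurent:
  assumes "flip p = p"
  obtains P where "p = subst_tplus P"
proof -
  let ?t = "\<lambda>k. Poly_Mapping.single k (1::complex)"
  have monomial: "\<exists>P. ?t (int n) + ?t (- int n) = subst_tplus P" for n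
  proof (induction n rule: induct_nat_012)
    case 0
    show ?case by (intro exI[of _ "[:2:]"]) (simp flip: single_add)
  next
    case 1
    show ?case by (intro exI[of _ "[:0, 1:]"]) (simp add: tplus_def)
  next
    case (ge2 n)
    then obtain P Q where
      PQ: "?t (int n) + ?t (- int n) = subst_tplus P"
        "?t (int (Suc n)) + ?t (- int (Suc n)) = subst_tplus Q"
      by blast
    have [simp]: "- 2 - int n = - int n - 2" by simp
    have "subst_tplus (pCons 0 Q + smult (-1) P) = tplus * subst_tplus Q - subst_tplus P"
      by (simp only: subst_add subst_smult) (simp add: single_uminus)
    also have "\<dots> = ?t (int (Suc (Suc n))) + ?t (- int (Suc (Suc n)))"
      unfolding PQ[symmetric] by (simp add: tplus_def algebra_simps mult_single)
    finally show ?case by metis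
  qed
  \<comment> \<open>The induction runs over arbitrary \<open>q\<close> because single monomials are
    not symmetric; a symmetric \<open>p\<close> then gives 2p.\<close>
  have "\<exists>P. q + flip q = subst_tplus P" for q
  proof (induction q rule: laurent_induct)
    case (single k c)
    obtain P where P: "?t (int (nat \<bar>k\<bar>)) + ?t (- int (nat \<bar>k\<bar>)) = subst_tplus P"
      using monomial by blast
    have "Poly_Mapping.single k c + flip (Poly_Mapping.single k c) =
        Poly_Mapping.single 0 c * (?t (int (nat \<bar>k\<bar>)) + ?t (- int (nat \<bar>k\<bar>)))"
      by (cases "k \<ge> 0") (simp_all add: map_key_uminus_single distrib_left mult_single add.commute)
    then show ?case unfolding P subst_smult[symmetric] by blast
  next
    case (add p q)
    then obtain P Q where PQ: "p + flip p = subst_tplus P" "q + flip q = subst_tplus Q"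
      by blast
    have "p + q + flip (p + q) = (p + flip p) + (q + flip q)"
      by (simp add: flip_add)
    also have "\<dots> = subst_tplus (P + Q)"
      by (simp add: PQ subst_add distrib_right)
    finally have "p + q + flip (p + q) = subst_tplus (P + Q)" .
    then show ?case by blast
  qed
  then obtain P where "p + p = subst_tplus P" using assms by metis
  then have "subst_tplus (smult (1/2) P) = Poly_Mapping.single 0 (1/2) * (p + p)"
    by (simp add: subst_smult)
  also have "\<dots> = p"
    by (rule half_double)
  finally show ?thesis using that by metis
qed

text \<open>The same recurrence with starting values 0 and 1 yields the quotients of t^n - t^(-n) by
  t - 1/t, which are Chebyshev polynomials of the second kind up to rescaling.\<close>

lemma antisymmetric_laurent:
  assumes "flip p = - p"
  obtains P where "p = subst_tplus P * tminus"
proof -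
  let ?t = "\<lambda>k. Poly_Mapping.single k (1::complex)"
  have monomial: "\<exists>P. ?t (int n) - ?t (- int n) = subst_tplus P * tminus" for n
  proof (induction n rule: induct_nat_012)
    case 0
    show ?case by (intro exI[of _ 0]) simp
  next
    case 1
    show ?case by (intro exI[of _ 1]) (simp add: tminus_def)
  next
    case (ge2 n)
    then obtain P Q where
      PQ: "?t (int n) - ?t (- int n) = subst_tplus P * tminus"
        "?t (int (Suc n)) - ?t (- int (Suc n)) = subst_tplus Q * tminus"
      by blast
    have [simp]: "- 2 - int n = - int n - 2" by simp
    have "subst_tplus (pCons 0 Q + smult (-1) P) * tminus =
        tplus * (subst_tplus Q * tminus) - subst_tplus P * tminus"
      by (simp only: subst_add subst_smult) (simp add: single_uminus algebra_simps)
    also have "\<dots> = ?t (int (Suc (Suc n))) - ?t (- int (Suc (Suc n)))"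
      unfolding PQ[symmetric] by (simp add: tplus_def algebra_simps mult_single)
    finally show ?case by metis
  qed
  have "\<exists>P. q - flip q = subst_tplus P * tminus" for q
  proof (induction q rule: laurent_induct)
    case (single k c)
    obtain P where P: "?t (int (nat \<bar>k\<bar>)) - ?t (- int (nat \<bar>k\<bar>)) = subst_tplus P * tminus"
      using monomial by blast
    \<comment> \<open>Replacing a negative exponent by its absolute value changes the sign of the
      antisymmetrized monomial.\<close>
    have "Poly_Mapping.single k c - flip (Poly_Mapping.single k c) =
        Poly_Mapping.single 0 (if k \<ge> 0 then c else - c) *
          (?t (int (nat \<bar>k\<bar>)) - ?t (- int (nat \<bar>k\<bar>)))"
      by (cases "k \<ge> 0")
        (simp_all add: map_key_uminus_single right_diff_distrib mult_single single_uminus)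
    then show ?case unfolding P mult.assoc[symmetric] subst_smult[symmetric] by blast
  next
    case (add p q)
    then obtain P Q where PQ: "p - flip p = subst_tplus P * tminus"
      "q - flip q = subst_tplus Q * tminus"
      by blast
    have "p + q - flip (p + q) = (p - flip p) + (q - flip q)"
      by (simp add: flip_add)
    also have "\<dots> = subst_tplus (P + Q) * tminus"
      by (simp add: PQ subst_add distrib_right)
    finally have "p + q - flip (p + q) = subst_tplus (P + Q) * tminus" .
    then show ?case by blast
  qed
  then obtain P where "p + p = subst_tplus P * tminus" using assms by (metis diff_minus_eq_add)
  then have "subst_tplus (smult (1/2) P) * tminus = Poly_Mapping.single 0 (1/2) * (p + p)"
    by (simp add: subst_smult mult.assoc)
  also have "\<dots> = p"
    by (rule half_double)
  finally show ?thesis using that by metis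
qed

section \<open>Triangular decomposition of the twisted algebra\<close>

lemma tensor_add: "tensor (P + Q) A = tensor P A + tensor Q A"
  by (simp add: tensor_def vec_eq_iff distrib_right)

lemma tensor_scale: "tensor (Poly_Mapping.single 0 c * P) A = loop_scale c (tensor P A)"
  by (simp add: tensor_def loop_scale_def vec_eq_iff mult.assoc)

lemma tensor_scaleR: "tensor P (r *\<^sub>R A) = loop_scale (of_real r) (tensor P A)"
  by (simp add: tensor_def loop_scale_def vec_eq_iff)
    (simp add: scaleR_conv_of_real single_zero_mult ac_simps)

lemma tensor_0 [simp]: "tensor P 0 = 0"
  by (simp add: tensor_def vec_eq_iff)

text \<open>\<theta> negates e and f and fixes h, so the e and f coordinates must be antisymmetric
  under inversion of t; this is why they carry the factor \<open>tminus\<close>.\<close>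

definition tw_e :: "complex poly \<Rightarrow> laurent^2^2" where
  "tw_e P = tensor (subst_tplus P * tminus) chev_e"

definition tw_f :: "complex poly \<Rightarrow> laurent^2^2" where
  "tw_f P = tensor (subst_tplus P * tminus) chev_f"

definition tw_h :: "complex poly \<Rightarrow> laurent^2^2" where
  "tw_h P = tensor (subst_tplus P) chev_h"

lemma tw_add:
  "tw_e (P + Q) = tw_e P + tw_e Q" "tw_f (P + Q) = tw_f P + tw_f Q" "tw_h (P + Q) = tw_h P + tw_h Q"
  by (simp_all add: tw_e_def tw_f_def tw_h_def subst_add distrib_right tensor_add)

lemma tw_smult:
  "tw_e (smult c P) = loop_scale c (tw_e P)"
  "tw_f (smult c P) = loop_scale c (tw_f P)"
  "tw_h (smult c P) = loop_scale c (tw_h P)"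
  by (simp_all add: tw_e_def tw_f_def tw_h_def subst_smult mult.assoc tensor_scale)

lemma tw_monom:
  "tw_e (monom c n) = loop_scale c (x_tw n 1)" "tw_h (monom c n) = loop_scale c (w_tw n 0)"
  by (simp_all add: tw_e_def tw_h_def x_tw_def w_tw_def subst_monom mult.assoc tensor_scale)

lemma tw_in_Ltw: "tw_e P \<in> Ltw" "tw_f P \<in> Ltw" "tw_h P \<in> Ltw"
  by (simp_all add: Ltw_def loop_algebra_def theta_def tw_e_def tw_f_def tw_h_def tensor_def
      trace_def sum_2 vec_eq_iff forall_2 chev_e_def chev_f_def chev_h_def flip_mult flip_subst
      flip_tminus flip_uminus single_uminus map_key_uminus_single)

lemma tw_commutator:
  "commutator (tw_h P) (tw_e Q) = loop_scale 2 (tw_e (P * Q))"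
  "commutator (tw_h P) (tw_f Q) = loop_scale (- 2) (tw_f (P * Q))"
  "commutator (tw_e P) (tw_f Q) = tw_h (rootp {2, -2} * P * Q)"
  "commutator (tw_h P) (tw_h Q) = 0" "commutator (tw_f P) (tw_f Q) = 0"
proof -
  have "subst_tplus P * tminus * (subst_tplus Q * tminus) = subst_tplus (rootp {2, -2} * P * Q)"
    unfolding subst_mult tminus_squared[symmetric] by (simp add: ac_simps)
  then show "commutator (tw_e P) (tw_f Q) = tw_h (rootp {2, -2} * P * Q)"
    by (simp add: tw_e_def tw_f_def tw_h_def commutator_tensor commutator_chev)
  have "commutator A A = 0" for A :: "complex^2^2" by (simp add: commutator_def)
  then show "commutator (tw_h P) (tw_h Q) = 0" "commutator (tw_f P) (tw_f Q) = 0"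
    by (simp_all add: tw_f_def tw_h_def commutator_tensor)
qed (simp_all only: tw_e_def tw_f_def tw_h_def commutator_tensor commutator_chev tensor_scaleR
    subst_mult mult.assoc, simp_all)

text \<open>Invariance under \<theta> makes diagonal entries symmetric and off-diagonal entries
  antisymmetric; trace zero ties the two diagonal entries together.\<close>

lemma Ltw_decomposition:
  assumes "A \<in> Ltw"
  obtains P Q R where "A = tw_e P + tw_f Q + tw_h R"
proof -
  have theta: "theta A = A" and trace: "trace A = 0"
    using assms by (auto simp: Ltw_def loop_algebra_def)
  have "theta A $ i $ j = A $ i $ j" for i j by (simp add: theta)
  note entry = this[unfolded theta_def, simplified]
  obtain R where R: "A $ 1 $ 1 = subst_tplus R"
    using symmetric_laurent entry[of 1 1] by auto
  have "flip (A $ 1 $ 2) = - (A $ 1 $ 2)"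
    using arg_cong[OF entry[of 1 2], of uminus] by simp
  then obtain P where P: "A $ 1 $ 2 = subst_tplus P * tminus"
    by (rule antisymmetric_laurent)
  have "flip (A $ 2 $ 1) = - (A $ 2 $ 1)"
    using arg_cong[OF entry[of 2 1], of uminus] by simp
  then obtain Q where Q: "A $ 2 $ 1 = subst_tplus Q * tminus"
    by (rule antisymmetric_laurent)
  have "A $ 2 $ 2 = - subst_tplus R"
    using trace R by (simp add: trace_def sum_2 eq_neg_iff_add_eq_0 add.commute)
  then have "A = tw_e P + tw_f Q + tw_h R"
    using P Q R by (simp add: tw_e_def tw_f_def tw_h_def tensor_def vec_eq_iff forall_2
        chev_e_def chev_f_def chev_h_def single_uminus)
  then show ?thesis by (rule that)
qed

text \<open>Since coefficients stay inside the monomials, additivity is enough. This serves both the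
  matrix-valued coordinates and the composite of \<phi> with \<open>tw_h\<close>.\<close>

lemma additive_monom_expansion:
  assumes "\<And>P Q. F (P + Q) = F P + F Q" "F 0 = 0"
  shows "F P = (\<Sum>i\<le>degree P. F (monom (coeff P i) i))"
proof -
  have "F (sum g S) = (\<Sum>s\<in>S. F (g s))" for g and S :: "nat set"
    by (induction S rule: infinite_finite_induct) (simp_all add: assms)
  then show ?thesis by (metis poly_as_sum_of_monoms)
qed

lemma tw_in_triangular: "tw_e P \<in> Ltw_plus" "tw_h P \<in> Ltw_zero"
proof -
  have 0: "tw_e 0 = 0" "tw_h 0 = 0"
    using tw_smult[of 0 0] by simp_all
  show "tw_e P \<in> Ltw_plus"
    unfolding Ltw_plus_def additive_monom_expansion[of tw_e P, OF tw_add(1) 0(1)] tw_monom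
    by (intro loop.span_sum loop.span_scale loop.span_base rangeI)
  show "tw_h P \<in> Ltw_zero"
    unfolding Ltw_zero_def additive_monom_expansion[of tw_h P, OF tw_add(3) 0(2)] tw_monom
    by (intro loop.span_sum loop.span_scale loop.span_base rangeI)
qed

section \<open>The classification\<close>

text \<open>Each point \<open>b\<close> is listed \<open>m b\<close> times. The function
  \<open>f\<close> is quantified after the sequence so that one sequence serves all exponents
  a.\<close>

lemma sum_multiplicity_as_sequence:
  assumes "finite \<Lambda>"
  shows "\<exists>n \<beta>. (\<forall>i\<in>{1..n}. \<beta> i \<in> \<Lambda>) \<and>
    (\<forall>f::complex \<Rightarrow> complex. (\<Sum>b\<in>\<Lambda>. of_nat (m b) * f b) = (\<Sum>i=1..n::nat. f (\<beta> i)))"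
  using assms
proof (induction \<Lambda> rule: finite_induct)
  case empty
  show ?case by (intro exI[of _ 0]) simp
next
  case (insert b \<Lambda>)
  then obtain n :: nat and \<beta> where \<beta>: "\<And>i. i \<in> {1..n} \<Longrightarrow> \<beta> i \<in> \<Lambda>"
    "\<And>f::complex \<Rightarrow> complex. (\<Sum>b\<in>\<Lambda>. of_nat (m b) * f b) = (\<Sum>i=1..n. f (\<beta> i))" by blast
  define \<gamma> where "\<gamma> i = (if i \<le> n then \<beta> i else b)" for i
  have "(\<Sum>c\<in>insert b \<Lambda>. of_nat (m c) * f c) = (\<Sum>i=1..n + m b. f (\<gamma> i))" for f :: "complex \<Rightarrow> complex"
  proof -
    have "(\<Sum>i=1..n + m b. f (\<gamma> i)) = (\<Sum>i=1..n. f (\<gamma> i)) + (\<Sum>i=n + 1..n + m b. f (\<gamma> i))"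
      by (rule sum.ub_add_nat) simp
    also have "(\<Sum>i=1..n. f (\<gamma> i)) = (\<Sum>i=1..n. f (\<beta> i))"
      by (intro sum.cong) (auto simp: \<gamma>_def)
    also have "(\<Sum>i=n + 1..n + m b. f (\<gamma> i)) = (\<Sum>i=n + 1..n + m b. f b)"
      by (intro sum.cong) (auto simp: \<gamma>_def)
    finally show ?thesis using insert.hyps by (simp add: \<beta>(2))
  qed
  moreover have "\<gamma> i \<in> insert b \<Lambda>" if "i \<in> {1..n + m b}" for i
    using that \<beta>(1) by (auto simp: \<gamma>_def)
  ultimately show ?case by blast
qed

text \<open>\<alpha> is a root of z^2 - b z + 1; it is nonzero, and it could equal 1 or -1 only for
  b = 2 or b = -2.\<close>

lemma ex_add_inverse_eq:
  fixes b :: complex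
  assumes "b \<notin> {2, -2}"
  shows "\<exists>\<alpha>. \<alpha> \<notin> {0, 1, -1} \<and> \<alpha> + inverse \<alpha> = b"
proof -
  define \<alpha> where "\<alpha> = (b + csqrt (b\<^sup>2 - 4)) / 2"
  have "csqrt (b\<^sup>2 - 4) ^ 2 = b\<^sup>2 - 4" by simp
  moreover have "csqrt (b\<^sup>2 - 4) = 2 * \<alpha> - b" by (simp add: \<alpha>_def field_simps)
  ultimately have "(2 * \<alpha> - b)\<^sup>2 = b\<^sup>2 - 4" by simp
  then have "4 * (\<alpha> * \<alpha> + 1) = 4 * (b * \<alpha>)"
    by (simp add: power2_eq_square algebra_simps)
  then have eq: "\<alpha> * \<alpha> + 1 = b * \<alpha>"
    by (simp only: mult_cancel_left) simp
  then have "\<alpha> \<noteq> 0" by auto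
  moreover have "\<alpha> \<noteq> 1" "\<alpha> \<noteq> -1" using eq assms by (auto simp: minus_equation_iff[of b])
  moreover have "\<alpha> + inverse \<alpha> = b" using eq \<open>\<alpha> \<noteq> 0\<close> by (simp add: field_simps)
  ultimately show ?thesis by blast
qed

text \<open>The values 2 and -2 would force the square of \<alpha> - 1 or of \<alpha> + 1 to
  vanish.\<close>

lemma add_inverse_neq:
  fixes \<alpha> :: complex
  assumes "\<alpha> \<notin> {0, 1, -1}"
  shows "\<alpha> + inverse \<alpha> \<notin> {2, -2}"
proof
  assume "\<alpha> + inverse \<alpha> \<in> {2, -2}"
  moreover have "\<alpha> \<noteq> 0" using assms by simp
  ultimately have "\<alpha> * \<alpha> + 1 = 2 * \<alpha> \<or> \<alpha> * \<alpha> + 1 = - 2 * \<alpha>"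
    by (auto simp: field_simps)
  moreover have "(\<alpha> - 1) * (\<alpha> - 1) = (\<alpha> * \<alpha> + 1) - 2 * \<alpha>" "(\<alpha> + 1) * (\<alpha> + 1) = (\<alpha> * \<alpha> + 1) + 2 * \<alpha>"
    by (simp_all add: algebra_simps)
  ultimately have "(\<alpha> - 1) * (\<alpha> - 1) = 0 \<or> (\<alpha> + 1) * (\<alpha> + 1) = 0"
    by auto
  then show False using assms by (auto simp: eq_neg_iff_add_eq_0)
qed

lemma (in vector_space) finite_dimensional_iff_finite_span:
  "(\<exists>Basis. finite_dimensional_vector_space scale Basis) \<longleftrightarrow> (\<exists>B. finite B \<and> span B = UNIV)"
proof
  assume "\<exists>Basis. finite_dimensional_vector_space scale Basis"
  then show "\<exists>B. finite B \<and> span B = UNIV"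
    using finite_dimensional_vector_space.finite_Basis finite_dimensional_vector_space.span_Basis
    by blast
next
  assume "\<exists>B. finite B \<and> span B = UNIV"
  then obtain B where "finite B" "span B = UNIV" by blast
  moreover obtain C where C: "C \<subseteq> B" "independent C" "B \<subseteq> span C"
    using maximal_independent_subset by blast
  ultimately have "finite_dimensional_vector_space scale C"
    using span_minimal[OF C(3)] finite_subset
    by unfold_locales auto
  then show "\<exists>Basis. finite_dimensional_vector_space scale Basis" by blast
qed

lemma weight_on_polynomials:
  assumes "\<phi> \<in> Ltw_zero_dual"
  shows "\<phi> (tw_h P) = (\<Sum>i\<le>degree P. coeff P i * \<phi> (w_tw i 0))"
proof -
  have add: "\<phi> (tw_h (P + Q)) = \<phi> (tw_h P) + \<phi> (tw_h Q)" for P Q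
    using assms tw_in_triangular(2) by (simp add: Ltw_zero_dual_def tw_add)
  have smult: "\<phi> (tw_h (smult c P)) = c * \<phi> (tw_h P)" for c P
    using assms tw_in_triangular(2) by (simp add: Ltw_zero_dual_def tw_smult)
  have zero: "\<phi> (tw_h 0) = 0" using smult[of 0 0] by simp
  have "\<phi> (tw_h (monom c i)) = c * \<phi> (w_tw i 0)" for c i
    using smult[of c "monom 1 i"] by (simp add: tw_monom smult_monom)
  then show ?thesis
    using additive_monom_expansion[of "\<lambda>P. \<phi> (tw_h P)" P, OF add zero] by simp
qed

lemma Ltw_add: "\<lbrakk>A \<in> Ltw; B \<in> Ltw\<rbrakk> \<Longrightarrow> A + B \<in> Ltw"
proof -
  have "theta (A + B) = theta A + theta B"
    by (simp add: theta_def vec_eq_iff flip_add)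
  then show "\<lbrakk>A \<in> Ltw; B \<in> Ltw\<rbrakk> \<Longrightarrow> A + B \<in> Ltw"
    by (simp add: Ltw_def loop_algebra_def trace_add)
qed

text \<open>The commutator formulas give the relations. Simplicity transfers because, by the
  triangular decomposition, a subspace stable under the three families is a submodule.\<close>

lemma simple_highest_weight_module_as_tw_simple_module:
  assumes "simple_highest_weight_module cscale act \<phi>"
  shows "\<exists>v. tw_simple_module cscale (\<lambda>P. act (tw_e P)) (\<lambda>P. act (tw_f P)) (\<lambda>P. act (tw_h P))
    {2, -2} v (\<lambda>P. \<phi> (tw_h P))"
proof -
  interpret V: Ltw_module cscale act
    using assms by (simp add: simple_highest_weight_module_def)
  obtain v where v: "V.highest_weight_vector \<phi> v" and simple: "V.simple"
    using assms by (auto simp: simple_highest_weight_module_def)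
  have commutator: "act A (act B u) = act B (act A u) + act (commutator A B) u"
    if "A \<in> Ltw" "B \<in> Ltw" for A B u
    using V.act_commutator[OF that] by simp
  have act_0: "act 0 u = 0" for u
    using V.act_scale[OF tw_in_Ltw(1)[of 0], of 0] by (simp add: V.scale_zero_left)
  have "tw_simple_module cscale (\<lambda>P. act (tw_e P)) (\<lambda>P. act (tw_f P)) (\<lambda>P. act (tw_h P))
    {2, -2} v (\<lambda>P. \<phi> (tw_h P))"
  proof (intro tw_simple_module.intro tw_simple_module_axioms.intro)
    fix W
    assume W: "V.subspace W" "\<And>P u. u \<in> W \<Longrightarrow> act (tw_e P) u \<in> W"
      "\<And>P u. u \<in> W \<Longrightarrow> act (tw_f P) u \<in> W" "\<And>P u. u \<in> W \<Longrightarrow> act (tw_h P) u \<in> W"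
    have "act A u \<in> W" if "A \<in> Ltw" "u \<in> W" for A u
    proof -
      obtain P Q R where "A = tw_e P + tw_f Q + tw_h R"
        using Ltw_decomposition[OF \<open>A \<in> Ltw\<close>] .
      then have "act A u = act (tw_e P) u + act (tw_f Q) u + act (tw_h R) u"
        by (simp add: V.act_add tw_in_Ltw Ltw_add)
      then show ?thesis using W that by (simp add: V.subspace_add)
    qed
    then have "V.submodule W" using W(1) by (simp add: V.submodule_def)
    then show "W = {0} \<or> W = UNIV" using simple by (auto simp: V.simple_def)
  next
    show "act (tw_f P) (act (tw_f Q) u) = act (tw_f Q) (act (tw_f P) u)" for P Q u
      using commutator[OF tw_in_Ltw(2,2), of P Q u] by (simp add: tw_commutator act_0)
    show "act (tw_h P) (act (tw_h Q) u) = act (tw_h Q) (act (tw_h P) u)" for P Q u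
      using commutator[OF tw_in_Ltw(3,3), of P Q u] by (simp add: tw_commutator act_0)
    show "act (tw_h P) (act (tw_e Q) u) =
        act (tw_e Q) (act (tw_h P) u) + cscale 2 (act (tw_e (P * Q)) u)" for P Q u
      using commutator[OF tw_in_Ltw(3,1), of P Q u]
      by (simp add: tw_commutator V.act_scale tw_in_Ltw)
    show "act (tw_h P) (act (tw_f Q) u) =
        act (tw_f Q) (act (tw_h P) u) - cscale 2 (act (tw_f (P * Q)) u)" for P Q u
      using commutator[OF tw_in_Ltw(3,2), of P Q u]
      by (simp only: tw_commutator V.act_scale[OF tw_in_Ltw(2)]) (simp add: V.scale_minus_left)
    show "act (tw_e P) (act (tw_f Q) u) =
        act (tw_f Q) (act (tw_e P) u) + act (tw_h (rootp {2, -2} * P * Q)) u" for P Q u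
      using commutator[OF tw_in_Ltw(1,2), of P Q u] by (simp only: tw_commutator)
  qed (use v in \<open>simp_all add: V.vector_space_axioms V.act_linear V.act_add V.act_scale
      tw_in_Ltw tw_add tw_smult V.highest_weight_vector_def tw_in_triangular\<close>)
  then show ?thesis by blast
qed

theorem theorem5p3p5:
  fixes \<phi> :: "laurent^2^2 \<Rightarrow> complex"
    and cscale :: "complex \<Rightarrow> 'v::ab_group_add \<Rightarrow> 'v"
    and act :: "laurent^2^2 \<Rightarrow> 'v \<Rightarrow> 'v"
  assumes "\<phi> \<in> Ltw_zero_dual"
    and "simple_highest_weight_module cscale act \<phi>"
  shows "(\<exists>Basis. finite_dimensional_vector_space cscale Basis) \<longleftrightarrow>
    (\<exists>(\<nu>\<^sub>p::complex) (\<nu>\<^sub>m::complex) (n::nat) (\<alpha>::nat \<Rightarrow> complex).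
       (\<forall>i\<in>{1..n}. \<alpha> i \<notin> {0, 1, -1}) \<and>
       (\<forall>a. \<phi> (w_tw a 0) =
          \<nu>\<^sub>p * 2 ^ a + \<nu>\<^sub>m * (-2) ^ a + (\<Sum>i=1..n. (\<alpha> i + inverse (\<alpha> i)) ^ a)))"
proof -
  obtain v where "tw_simple_module cscale (\<lambda>P. act (tw_e P)) (\<lambda>P. act (tw_f P)) (\<lambda>P. act (tw_h P))
      {2, -2} v (\<lambda>P. \<phi> (tw_h P))"
    using simple_highest_weight_module_as_tw_simple_module[OF assms(2)] by blast
  then interpret V: tw_simple_module cscale "\<lambda>P. act (tw_e P)" "\<lambda>P. act (tw_f P)" "\<lambda>P. act (tw_h P)"
      "{2, -2}" v "\<lambda>P. \<phi> (tw_h P)" .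
  show ?thesis
    unfolding V.finite_dimensional_iff_finite_span
  proof
    assume "\<exists>B. finite B \<and> V.span B = UNIV"
    then obtain B where "finite B" "V.span B = UNIV" by blast
    from V.weight_if_finite_span[OF this] obtain \<Lambda> m \<nu> where \<Lambda>: "finite \<Lambda>" "\<Lambda> \<inter> {2, -2} = {}"
      and weight: "\<forall>P. \<phi> (tw_h P) =
        (\<Sum>\<mu>\<in>{2, -2}. \<nu> \<mu> * poly P \<mu>) + (\<Sum>b\<in>\<Lambda>. of_nat (m b) * poly P b)"
      by (elim exE conjE)
    obtain n \<beta> where \<beta>: "\<And>i. i \<in> {1..n} \<Longrightarrow> \<beta> i \<in> \<Lambda>"
      "\<And>f::complex \<Rightarrow> complex. (\<Sum>b\<in>\<Lambda>. of_nat (m b) * f b) = (\<Sum>i=1..n::nat. f (\<beta> i))"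
      using sum_multiplicity_as_sequence[OF \<Lambda>(1), of m] by blast
    have "\<exists>\<alpha>. \<alpha> \<notin> {0, 1, -1} \<and> \<alpha> + inverse \<alpha> = \<beta> i" if "i \<in> {1..n}" for i
      using \<beta>(1)[OF that] \<Lambda>(2) by (intro ex_add_inverse_eq) blast
    then obtain \<alpha> where \<alpha>: "\<And>i. i \<in> {1..n} \<Longrightarrow> \<alpha> i \<notin> {0, 1, -1} \<and> \<alpha> i + inverse (\<alpha> i) = \<beta> i"
      by metis
    have "\<phi> (w_tw a 0) =
        \<nu> 2 * 2 ^ a + \<nu> (-2) * (-2) ^ a + (\<Sum>i=1..n. (\<alpha> i + inverse (\<alpha> i)) ^ a)" for a
    proof -
      \<comment> \<open>Choosing P = z^a turns evaluation at a point into its a-th power.\<close>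
      have "\<phi> (w_tw a 0) = \<phi> (tw_h (monom 1 a))" by (simp add: tw_monom)
      also have "\<dots> = \<nu> 2 * 2 ^ a + \<nu> (-2) * (-2) ^ a + (\<Sum>i=1..n. \<beta> i ^ a)"
        by (simp add: weight[rule_format] poly_monom \<beta>(2))
      also have "(\<Sum>i=1..n. \<beta> i ^ a) = (\<Sum>i=1..n. (\<alpha> i + inverse (\<alpha> i)) ^ a)"
        using \<alpha> by (intro sum.cong) auto
      finally show ?thesis .
    qed
    then show "\<exists>\<nu>\<^sub>p \<nu>\<^sub>m (n::nat) \<alpha>. (\<forall>i\<in>{1..n}. \<alpha> i \<notin> {0, 1, -1}) \<and> (\<forall>a. \<phi> (w_tw a 0) =
        \<nu>\<^sub>p * 2 ^ a + \<nu>\<^sub>m * (-2) ^ a + (\<Sum>i=1..n. (\<alpha> i + inverse (\<alpha> i)) ^ a))"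
      using \<alpha> by blast
  next
    assume "\<exists>\<nu>\<^sub>p \<nu>\<^sub>m (n::nat) \<alpha>. (\<forall>i\<in>{1..n}. \<alpha> i \<notin> {0, 1, -1}) \<and> (\<forall>a. \<phi> (w_tw a 0) =
        \<nu>\<^sub>p * 2 ^ a + \<nu>\<^sub>m * (-2) ^ a + (\<Sum>i=1..n. (\<alpha> i + inverse (\<alpha> i)) ^ a))"
    then obtain \<nu>\<^sub>p \<nu>\<^sub>m \<alpha> and n :: nat where \<alpha>: "\<And>i. i \<in> {1..n} \<Longrightarrow> \<alpha> i \<notin> {0, 1, -1}"
      and weight: "\<And>a. \<phi> (w_tw a 0) =
        \<nu>\<^sub>p * 2 ^ a + \<nu>\<^sub>m * (-2) ^ a + (\<Sum>i=1..n. (\<alpha> i + inverse (\<alpha> i)) ^ a)"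
      by blast
    define \<beta> where "\<beta> i = \<alpha> i + inverse (\<alpha> i)" for i
    define \<nu> where "\<nu> \<mu> = (if \<mu> = 2 then \<nu>\<^sub>p else \<nu>\<^sub>m)" for \<mu> :: complex
    show "\<exists>B. finite B \<and> V.span B = UNIV"
    proof (rule V.finite_span_if_weight)
      show "finite (\<beta> ` {1..n})" by simp
      show "\<beta> ` {1..n} \<inter> {2, -2} = {}"
        using add_inverse_neq \<alpha> unfolding \<beta>_def by blast
      fix P
      have "\<phi> (tw_h P) =
          (\<Sum>i\<le>degree P. coeff P i * (\<nu>\<^sub>p * 2 ^ i + \<nu>\<^sub>m * (-2) ^ i + (\<Sum>j=1..n. \<beta> j ^ i)))"
        unfolding weight_on_polynomials[OF assms(1)] weight \<beta>_def ..
      also have "\<dots> = \<nu>\<^sub>p * poly P 2 + \<nu>\<^sub>m * poly P (-2) +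
          (\<Sum>i\<le>degree P. \<Sum>j=1..n. coeff P i * \<beta> j ^ i)"
        by (simp add: poly_altdef sum_distrib_left sum.distrib distrib_left ac_simps)
      also have "(\<Sum>i\<le>degree P. \<Sum>j=1..n. coeff P i * \<beta> j ^ i) = (\<Sum>j=1..n. poly P (\<beta> j))"
        unfolding poly_altdef by (rule sum.swap)
      \<comment> \<open>Different \<alpha> can give the same point, for instance \<alpha> and its
        inverse, so the multiplicity is the size of the fibre.\<close>
      also have "\<dots> = (\<Sum>b\<in>\<beta> ` {1..n}. of_nat (card {j \<in> {1..n}. \<beta> j = b}) * poly P b)"
        by (subst sum.image_gen[of _ _ \<beta>]) simp_all
      also have "\<nu>\<^sub>p * poly P 2 + \<nu>\<^sub>m * poly P (-2) = (\<Sum>\<mu>\<in>{2, -2}. \<nu> \<mu> * poly P \<mu>)"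
        by (simp add: \<nu>_def)
      finally show "\<phi> (tw_h P) = (\<Sum>\<mu>\<in>{2, -2}. \<nu> \<mu> * poly P \<mu>) +
          (\<Sum>b\<in>\<beta> ` {1..n}. of_nat (card {j \<in> {1..n}. \<beta> j = b}) * poly P b)" .
    qed
  qed
qed

end
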